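(* Fix $\tau>0$ and $\mathbf{M}=(M_1,\dots,M_N)\in\mathbb{N}^N$. For each $n\in\mathbb{N}$ let $u_n^{\tau,\mathbf{M}}\in V_{n,C_n}^{\sigma}(\mathcal{T}_h)$ be a minimizer of the truncated loss functional over the bounded-parameter discontinuous network class, i.e. $\mathcal{J}_{\tau}^{h,\mathbf{M}}(u_n^{\tau,\mathbf{M}})=\min_{v\in V_{n,C_n}^{\sigma}(\mathcal{T}_h)}\mathcal{J}_{\tau}^{h,\mathbf{M}}(v)$. Then $\mathcal{J}_{\tau}^{h,\mathbf{M}}(u_n^{\tau,\mathbf{M}})\to 0$ as $n\to\infty$.
   Context: **Mesh and problem.** Let $\Omega\subset\mathbb{R}$ be a bounded interval with mesh nodes $x_0<x_1<\cdots<x_N$, elements $\Omega_k=[x_{k-1},x_k]$, $k=1,\dots,N$, and partition $\mathcal{T}_h=\{\Omega_k\}_{k=1}^N$. $V(\mathcal{T}_h)$ is a Banach space of (complex-valued, elementwise defined) functions on $\Omega$; $Z$ and $W$ are Banach spaces; $Y$ is a Hilbert space of functions on $\Omega$. $\mathcal{A}:V(\mathcal{T}_h)\to Y$ and $\mathcal{B}:V(\mathcal{T}_h)\to Z$ are bounded linear operators, and $v\mapsto[[C_1v]]$, $v\mapsto[[C_2v]]$ are bounded linear operators $V(\mathcal{T}_h)\to W$ (jump quantities on the set of interior nodes $x_1,\dots,x_{N-1}$). The data $f\in Y$, $g\in Z$ define the linear boundary value problem $\mathcal{A}u=f$ in $\Omega$, $\mathcal{B}u=g$ on $\partial\Omega$.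 It is assumed that this problem has an exact solution $u\in V(\mathcal{T}_h)$, whose jumps vanish: $[[C_1u]]=[[C_2u]]=0$. **Basis.** $Y_k=Y|_{\Omega_k}$ is a Hilbert space, $Y$ is the orthogonal direct sum of $Y_1,\dots,Y_N$, and for each $k$, $\{\varphi_{k,i}\}_{i=1}^\infty$ is a complete orthonormal basis of $Y_k$ (so that all the $\varphi_{k,i}$ together form a complete orthonormal basis of $Y$). **Truncated loss functional.** For $v\in V(\mathcal{T}_h)$, $$\mathcal{J}_{\tau}^{h,\mathbf{M}}(v)=\sum_{k=1}^{N}\sum_{i=1}^{M_k}|(\mathcal{A}v-f,\varphi_{k,i})_{Y_k}|^2+\tau\left(\|\mathcal{B}v-g\|_Z^2+\|[[C_1v]]\|_W^2+\|[[C_2v]]\|_W^2\right).$$ **Discontinuous networks.** $\sigma:\mathbb{R}\to\mathbb{C}$ is a bounded smooth activation function. $V_n^\sigma(\mathcal{T}_h)$ is the set of functions $v$ with $v|_{\Omega_k}(x)=\sum_{j=1}^n c_j^{(k)}\sigma(W_j^{(k)}x+b_j^{(k)})$ for $k=1,\dots,N$, where $W_j^{(k)},b_j^{(k)}\in\mathbb{R}$ and $c_j^{(k)}\in\mathbb{C}$. For the parameter collection $\Theta$ put $\|\Theta\|=\max_k\left(\max_j|W_j^{(k)}|+\max_j|b_j^{(k)}|+\max_j|c_j^{(k)}|\right)$. Let $(C_n)_{n\ge1}$ be an increasing sequence of positive numbers with $C_n\to\infty$, and let $V_{n,C_n}^\sigma(\mathcal{T}_h)$ be the set of $v\in V_n^\sigma(\mathcal{T}_h)$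 that can be represented with parameters satisfying $\|\Theta\|\le C_n$. **Standing assumptions on the networks.** $V_n^\sigma(\mathcal{T}_h)\subset V(\mathcal{T}_h)$ for all $n$; each $V_{n,C_n}^\sigma(\mathcal{T}_h)$ is compact in $V(\mathcal{T}_h)$; and the universal approximation property holds: $\bigcup_{n}V_n^\sigma(\mathcal{T}_h)$ is dense in $V(\mathcal{T}_h)$. *)

theory Defs
  imports "HOL-Analysis.Analysis"
begin

section \<open>Complex Banach and Hilbert spaces\<close>

class complex_banach = banach +
  fixes scaleC :: "complex \<Rightarrow> 'a \<Rightarrow> 'a"
  assumes scaleC_add_right: "scaleC c (v + w) = scaleC c v + scaleC c w"
    and scaleC_add_left: "scaleC (c + d) v = scaleC c v + scaleC d v"
    and scaleC_scaleC: "scaleC c (scaleC d v) = scaleC (c * d) v"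
    and scaleC_of_real: "scaleC (complex_of_real r) v = scaleR r v"
    and norm_scaleC: "norm (scaleC c v) = cmod c * norm v"

text \<open>The inner product is linear in its first argument.\<close>

class complex_hilbert = complex_banach +
  fixes cinner :: "'a \<Rightarrow> 'a \<Rightarrow> complex"
  assumes cinner_commute: "cinner v w = cnj (cinner w v)"
    and cinner_add_left: "cinner (v + v') w = cinner v w + cinner v' w"
    and cinner_scaleC_left: "cinner (scaleC c v) w = c * cinner v w"
    and cinner_self: "cinner v v = complex_of_real ((norm v)\<^sup>2)"

definition bounded_clinear :: "('a::complex_banach \<Rightarrow> 'b::complex_banach) \<Rightarrow> bool" where
  "bounded_clinear T \<longleftrightarrow>
     bounded_linear T \<and> (\<forall>c v. T (scaleC c v) = scaleC c (T v))"

definition orthogonal_direct_sum ::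
    "nat \<Rightarrow> (nat \<Rightarrow> 'a::complex_hilbert set) \<Rightarrow> bool" where
  "orthogonal_direct_sum N U \<longleftrightarrow>
     (\<forall>j\<in>{1..N}. \<forall>k\<in>{1..N}. j \<noteq> k \<longrightarrow> (\<forall>v\<in>U j. \<forall>w\<in>U k. cinner v w = 0)) \<and>
     (\<forall>y. \<exists>a. (\<forall>k\<in>{1..N}. a k \<in> U k) \<and> y = (\<Sum>k=1..N. a k))"

text \<open>The basis vectors are indexed by \<open>1, 2, 3, \<dots>\<close>; the value at index 0 is irrelevant.\<close>

definition complete_orthonormal_basis ::
    "(nat \<Rightarrow> 'a::complex_hilbert) \<Rightarrow> 'a set \<Rightarrow> bool" where
  "complete_orthonormal_basis \<phi> U \<longleftrightarrow>
     (\<forall>i\<ge>1. \<forall>j\<ge>1. cinner (\<phi> i) (\<phi> j) = (if i = j then 1 else 0)) \<and>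
     closure (module.span scaleC (\<phi> ` {1..})) = U"


section \<open>Mesh and spaces of functions\<close>

definition mesh :: "(nat \<Rightarrow> real) \<Rightarrow> nat \<Rightarrow> bool" where
  "mesh x N \<longleftrightarrow> N \<ge> 1 \<and> (\<forall>k\<in>{1..N}. x (k - 1) < x k)"

definition element :: "(nat \<Rightarrow> real) \<Rightarrow> nat \<Rightarrow> real set" where
  "element x k = {x (k - 1)..x k}"

text \<open>
  An elementwise defined function is a function on the disjoint union of the closed elements:
  its argument \<open>(k, t)\<close> is the point \<open>t\<close> regarded as a point of element \<open>k\<close>, so that it has
  two independent values at every interior node.  The measure on the disjoint union
  is Lebesgue measure on each element.
\<close>

definition omega_measure :: "(nat \<Rightarrow> real) \<Rightarrow> nat \<Rightarrow> real measure" where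
  "omega_measure x N = restrict_space lborel {x 0..x N}"

definition broken_measure :: "(nat \<Rightarrow> real) \<Rightarrow> nat \<Rightarrow> (nat \<times> real) measure" where
  "broken_measure x N =
     restrict_space (count_space UNIV \<Otimes>\<^sub>M lborel) (SIGMA k:{1..N}. element x k)"

text \<open>
  A Banach space of functions on the space of \<open>\<mu>\<close>: the type \<open>'a\<close> carries the vector space
  structure and the norm, \<open>X\<close> is the set of functions that represent elements of the space
  (extended by 0), and \<open>cls g\<close> is the element represented by \<open>g\<close>.  Two functions may represent
  the same element only if they agree almost everywhere.  This covers both spaces of genuine
  functions (\<open>cls\<close> injective on \<open>X\<close>) and spaces such as \<open>L\<^sup>2\<close>.
\<close>

locale function_space =
  fixes \<mu> :: "'p measure"
    and X :: "('p \<Rightarrow> complex) set"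
    and cls :: "('p \<Rightarrow> complex) \<Rightarrow> 'a::complex_banach"
  assumes supported: "g \<in> X \<Longrightarrow> p \<notin> space \<mu> \<Longrightarrow> g p = 0"
    and add_closed: "g \<in> X \<Longrightarrow> h \<in> X \<Longrightarrow> (\<lambda>p. g p + h p) \<in> X"
    and scale_closed: "g \<in> X \<Longrightarrow> (\<lambda>p. c * g p) \<in> X"
    and cls_add: "g \<in> X \<Longrightarrow> h \<in> X \<Longrightarrow> cls (\<lambda>p. g p + h p) = cls g + cls h"
    and cls_scale: "g \<in> X \<Longrightarrow> cls (\<lambda>p. c * g p) = scaleC c (cls g)"
    and cls_onto: "cls ` X = UNIV"
    and cls_eq_0: "g \<in> X \<Longrightarrow> cls g = 0 \<Longrightarrow> AE p in \<mu>. g p = 0"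

text \<open>
  \<open>Y\<^sub>k = Y|\<^bsub>\<Omega>\<^sub>k\<^esub>\<close> is regarded as a subspace of \<open>Y\<close>, a restriction to an element being
  extended by 0; its inner product is the one of \<open>Y\<close>.
\<close>

definition cut_off :: "real set \<Rightarrow> (real \<Rightarrow> complex) \<Rightarrow> real \<Rightarrow> complex" where
  "cut_off S g = (\<lambda>t. if t \<in> S then g t else 0)"

definition restricted_space ::
    "(real \<Rightarrow> complex) set \<Rightarrow> ((real \<Rightarrow> complex) \<Rightarrow> 'y) \<Rightarrow> real set \<Rightarrow> 'y set" where
  "restricted_space X cls S = (\<lambda>g. cls (cut_off S g)) ` X"

definition restriction ::
    "(real \<Rightarrow> complex) set \<Rightarrow> ((real \<Rightarrow> complex) \<Rightarrow> 'y) \<Rightarrow> real set \<Rightarrow> 'y \<Rightarrow> 'y" where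
  "restriction X cls S y = cls (cut_off S (inv_into X cls y))"


section \<open>Truncated loss functional\<close>

definition truncated_loss ::
    "(nat \<Rightarrow> real) \<Rightarrow> nat \<Rightarrow> (real \<Rightarrow> complex) set \<Rightarrow> ((real \<Rightarrow> complex) \<Rightarrow> 'y::complex_hilbert) \<Rightarrow>
     (nat \<Rightarrow> nat \<Rightarrow> 'y) \<Rightarrow> ('v \<Rightarrow> 'y) \<Rightarrow> ('v \<Rightarrow> 'z::complex_banach) \<Rightarrow>
     ('v \<Rightarrow> 'w::complex_banach) \<Rightarrow> ('v \<Rightarrow> 'w) \<Rightarrow> 'y \<Rightarrow> 'z \<Rightarrow> real \<Rightarrow> (nat \<Rightarrow> nat) \<Rightarrow> 'v \<Rightarrow> real" where
  "truncated_loss x N XY clsY \<phi> A B jump1 jump2 f g \<tau> M v =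
     (\<Sum>k=1..N. \<Sum>i=1..M k.
        (cmod (cinner (restriction XY clsY (element x k) (A v - f)) (\<phi> k i)))\<^sup>2)
     + \<tau> * ((norm (B v - g))\<^sup>2 + (norm (jump1 v))\<^sup>2 + (norm (jump2 v))\<^sup>2)"


section \<open>Discontinuous networks\<close>

definition smooth :: "(real \<Rightarrow> complex) \<Rightarrow> bool" where
  "smooth s \<longleftrightarrow>
     (\<exists>D. D 0 = s \<and> (\<forall>m t. (D m has_vector_derivative D (Suc m) t) (at t)))"

text \<open>In \<open>W k j\<close>, \<open>b k j\<close>, \<open>c k j\<close> the index \<open>k\<close> is the element and \<open>j\<close> the neuron.\<close>

definition network ::
    "(real \<Rightarrow> complex) \<Rightarrow> (nat \<Rightarrow> real) \<Rightarrow> nat \<Rightarrow> nat \<Rightarrow>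
     (nat \<Rightarrow> nat \<Rightarrow> real) \<Rightarrow> (nat \<Rightarrow> nat \<Rightarrow> real) \<Rightarrow> (nat \<Rightarrow> nat \<Rightarrow> complex) \<Rightarrow>
     nat \<times> real \<Rightarrow> complex" where
  "network \<sigma> x N n W b c = (\<lambda>(k, t).
     if k \<in> {1..N} \<and> t \<in> element x k
     then \<Sum>j=1..n. c k j * \<sigma> (W k j * t + b k j) else 0)"

definition param_norm ::
    "nat \<Rightarrow> nat \<Rightarrow> (nat \<Rightarrow> nat \<Rightarrow> real) \<Rightarrow> (nat \<Rightarrow> nat \<Rightarrow> real) \<Rightarrow> (nat \<Rightarrow> nat \<Rightarrow> complex) \<Rightarrow> real" where
  "param_norm N n W b c =
     (MAX k\<in>{1..N}. (MAX j\<in>{1..n}. \<bar>W k j\<bar>) + (MAX j\<in>{1..n}. \<bar>b k j\<bar>) + (MAX j\<in>{1..n}. cmod (c k j)))"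

definition network_class ::
    "(real \<Rightarrow> complex) \<Rightarrow> (nat \<Rightarrow> real) \<Rightarrow> nat \<Rightarrow> nat \<Rightarrow>
     ((nat \<times> real \<Rightarrow> complex) \<Rightarrow> 'v) \<Rightarrow> 'v set" where
  "network_class \<sigma> x N n cls = {cls (network \<sigma> x N n W b c) | W b c. True}"

definition bounded_network_class ::
    "(real \<Rightarrow> complex) \<Rightarrow> (nat \<Rightarrow> real) \<Rightarrow> nat \<Rightarrow> nat \<Rightarrow> real \<Rightarrow>
     ((nat \<times> real \<Rightarrow> complex) \<Rightarrow> 'v) \<Rightarrow> 'v set" where
  "bounded_network_class \<sigma> x N n R cls =
     {cls (network \<sigma> x N n W b c) | W b c. param_norm N n W b c \<le> R}"

end

theory Submission
  imports Defs
begin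

text \<open>
  The restriction to an element is the orthogonal projection onto \<open>Y\<^sub>k\<close>: an element of \<open>Y\<close> is
  the sum of its restrictions, because a function supported at an interior node lies in two
  adjacent, mutually orthogonal subspaces and hence represents 0.  So pairing the restricted
  residual with \<open>\<phi>\<^sub>k\<^sub>,\<^sub>i\<close> is the same as pairing the residual itself, and the truncated
  loss is a continuous functional that vanishes at the exact solution.  By density some network
  makes the loss small; padded with zero weights it belongs to all but finitely many of the
  bounded classes, and the minimizers do at least as well.
\<close>

section \<open>Algebra and continuity of the complex inner product\<close>

lemma scaleC_one: "scaleC 1 v = (v::'a::complex_banach)"
  using scaleC_of_real[of 1 v] by simp

text \<open>Makes the general facts about \<open>module.span\<close> applicable to the span that
  occurs in \<open>complete_orthonormal_basis\<close>.\<close>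

lemma module_scaleC: "module (scaleC :: complex \<Rightarrow> 'a::complex_banach \<Rightarrow> 'a)"
  by unfold_locales (simp_all add: scaleC_add_right scaleC_add_left scaleC_scaleC scaleC_one)

lemma cinner_zero_left: "cinner 0 w = 0"
  using cinner_add_left[of 0 0 w] by simp

lemma cinner_diff_left: "cinner (v - v') w = cinner v w - cinner v' w"
  using cinner_add_left[of "v - v'" v' w] by simp

lemma cinner_sum_left: "cinner (\<Sum>i\<in>I. v i) w = (\<Sum>i\<in>I. cinner (v i) w)"
  by (induction I rule: infinite_finite_induct) (simp_all add: cinner_zero_left cinner_add_left)

lemma cinner_scaleR_left: "cinner (r *\<^sub>R v) w = r *\<^sub>R cinner v w"
  unfolding scaleC_of_real[symmetric] cinner_scaleC_left by (simp add: scaleR_conv_of_real)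

lemma cinner_diff_right: "cinner w (v - v') = cinner w v - cinner w v'"
  by (metis cinner_commute cinner_diff_left complex_cnj_diff)

lemma cinner_scaleC_right: "cinner v (scaleC c w) = cnj c * cinner v w"
  by (metis cinner_commute cinner_scaleC_left complex_cnj_mult)

lemma cinner_self_eq_0: "cinner v v = 0 \<Longrightarrow> v = 0"
  by (simp add: cinner_self)

text \<open>Follows from the nonnegativity of the squared norm of a vector orthogonal to
  \<open>w\<close>. It gives the bound that makes pairing with a fixed vector continuous, and with
  it the loss.\<close>

lemma cauchy_schwarz: "cmod (cinner v w) \<le> norm v * norm w"
proof (cases "w = 0")
  case True
  then show ?thesis
    using cinner_commute[of v w] by (simp add: cinner_zero_left)
next
  case False
  define n where "n = (norm w)\<^sup>2"
  define c where "c = cinner v w"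
  \<comment> \<open>Up to the factor \<open>n\<close>, the component of \<open>v\<close> orthogonal
    to \<open>w\<close>; scaling by \<open>n\<close> avoids dividing by the squared norm of
    \<open>w\<close>.\<close>
  define z where "z = scaleC (complex_of_real n) v - scaleC c w"
  have n: "n > 0" using False by (simp add: n_def)
  have wv: "cinner w v = cnj c" using cinner_commute[of w v] by (simp add: c_def)
  have cc: "c * cnj c = complex_of_real ((cmod c)\<^sup>2)"
    by (simp only: complex_norm_square)
  have "complex_of_real ((norm z)\<^sup>2) =
      complex_of_real n * (complex_of_real n * complex_of_real ((norm v)\<^sup>2) - c * cnj c)"
  proof -
    have "complex_of_real ((norm z)\<^sup>2) = cinner z z" by (simp only: cinner_self)
    also have "\<dots> = complex_of_real n * (complex_of_real n * cinner v v - c * cnj c)"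
      unfolding z_def cinner_diff_left cinner_diff_right cinner_scaleC_left cinner_scaleC_right
        cinner_self[of w] wv
      by (simp add: c_def[symmetric] n_def[symmetric] algebra_simps)
    finally show ?thesis by (simp only: cinner_self)
  qed
  also have "\<dots> = complex_of_real (n * (n * (norm v)\<^sup>2 - (cmod c)\<^sup>2))"
    unfolding cc by simp
  finally have "(norm z)\<^sup>2 = n * (n * (norm v)\<^sup>2 - (cmod c)\<^sup>2)"
    by (simp only: of_real_eq_iff)
  then have "0 \<le> n * (n * (norm v)\<^sup>2 - (cmod c)\<^sup>2)"
    by (metis zero_le_power2)
  with n have "(cmod c)\<^sup>2 \<le> (norm v * norm w)\<^sup>2"
    by (simp add: zero_le_mult_iff n_def power_mult_distrib mult.commute)
  then show ?thesis
    unfolding c_def by (rule power2_le_imp_le) simp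
qed

lemma bounded_linear_cinner_left: "bounded_linear (\<lambda>v. cinner v w)"
  by (rule bounded_linear_intro[where K = "norm w"])
     (simp_all add: cinner_add_left cinner_scaleR_left cauchy_schwarz)

lemma complete_orthonormal_basis_in_space:
  assumes "complete_orthonormal_basis \<phi> U" and "i \<ge> 1"
  shows "\<phi> i \<in> U"
proof -
  have "\<phi> i \<in> module.span scaleC (\<phi> ` {1..})"
    using assms(2) by (intro module.span_base[OF module_scaleC]) auto
  then show ?thesis
    using assms(1) closure_subset unfolding complete_orthonormal_basis_def by blast
qed

section \<open>Cut-offs on the mesh and projection onto an element\<close>

lemma mesh_mono:
  assumes "mesh x N" and "i \<le> j" and "j \<le> N"
  shows "x i \<le> x j"
  using assms(2,3)
proof (induction j rule: dec_induct)
  case (step n)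
  then have "x n < x (Suc n)"
    using assms(1) unfolding mesh_def by (metis Suc_le_eq atLeastAtMost_iff diff_Suc_1 le_add1 plus_1_eq_Suc)
  with step show ?case by simp
qed simp

context function_space
begin

lemma diff_closed: "g \<in> X \<Longrightarrow> h \<in> X \<Longrightarrow> (\<lambda>p. g p - h p) \<in> X"
  using add_closed[OF _ scale_closed[where c = "-1"], of g h] by simp

lemma cls_diff:
  assumes "g \<in> X" and "h \<in> X"
  shows "cls (\<lambda>p. g p - h p) = cls g - cls h"
  using cls_add[OF diff_closed[OF assms] assms(2)] by simp

end

text \<open>Induction over the initial intervals \<open>{x 0..x m}\<close>. Appending the next
  closed element counts the shared node \<open>x m\<close> twice, and the surplus represents
  0.\<close>

lemma cls_eq_sum_cut_off:
  fixes clsY :: "(real \<Rightarrow> complex) \<Rightarrow> 'y::complex_hilbert"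
  assumes mesh: "mesh x N"
    and fs: "function_space (omega_measure x N) XY clsY"
    and cut: "\<And>k h. k \<in> {1..N} \<Longrightarrow> h \<in> XY \<Longrightarrow> cut_off (element x k) h \<in> XY"
    and orth: "orthogonal_direct_sum N (\<lambda>k. restricted_space XY clsY (element x k))"
    and h: "h \<in> XY"
  shows "clsY h = (\<Sum>k=1..N. clsY (cut_off (element x k) h))"
proof -
  interpret function_space "omega_measure x N" XY clsY by (rule fs)
  have N: "1 \<le> N" using mesh by (simp add: mesh_def)
  have part: "cut_off {x 0..x m} h \<in> XY \<and>
      clsY (cut_off {x 0..x m} h) = (\<Sum>k=1..m. clsY (cut_off (element x k) h))"
    if "1 \<le> m" "m \<le> N" for m
    using that
  proof (induction m rule: dec_induct)
    case base
    then show ?case using cut[OF _ h, of 1] N by (simp add: element_def)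
  next
    case (step m)
    let ?E = "\<lambda>k. cut_off (element x k)"
    have m: "m \<in> {1..N}" "Suc m \<in> {1..N}" using step.hyps step.prems by auto
    have IH: "cut_off {x 0..x m} h \<in> XY"
        "clsY (cut_off {x 0..x m} h) = (\<Sum>k=1..m. clsY (?E k h))"
      using step by auto
    \<comment> \<open>The surplus: \<open>h\<close> on the common node \<open>x m\<close>, and 0
      elsewhere.\<close>
    define d where "d = ?E m (?E (Suc m) h)"
    have E: "?E (Suc m) h \<in> XY" "?E m h \<in> XY" using cut h m by auto
    have d: "d \<in> XY" using cut E m unfolding d_def by auto
    \<comment> \<open>Cut-offs commute, so \<open>clsY d\<close> lies in the subspaces of both
      adjacent elements and is orthogonal to itself.\<close>
    have d': "d = ?E (Suc m) (?E m h)"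
      by (auto simp: d_def cut_off_def)
    have "clsY d \<in> restricted_space XY clsY (element x m)"
      using E unfolding d_def restricted_space_def by blast
    moreover have "clsY d \<in> restricted_space XY clsY (element x (Suc m))"
      using E unfolding d' restricted_space_def by blast
    ultimately have "cinner (clsY d) (clsY d) = 0"
      using orth m unfolding orthogonal_direct_sum_def by (metis n_not_Suc_n)
    then have d0: "clsY d = 0" by (rule cinner_self_eq_0)
    have le: "x 0 \<le> x (m - 1)" "x (m - 1) \<le> x m" "x m \<le> x (Suc m)"
      using m by (auto intro!: mesh_mono[OF mesh])
    have eq: "cut_off {x 0..x (Suc m)} h =
        (\<lambda>t. (cut_off {x 0..x m} h t + ?E (Suc m) h t) - d t)"
      using le by (auto simp: d_def cut_off_def element_def fun_eq_iff)
    show ?case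
      unfolding eq
      using IH E d d0 m
      by (simp add: diff_closed add_closed cls_diff cls_add)
  qed
  \<comment> \<open>Functions in \<open>XY\<close> are extended by 0 outside the whole
    interval.\<close>
  have "cut_off {x 0..x N} h = h"
    using supported[OF h]
    by (auto simp: cut_off_def fun_eq_iff omega_measure_def space_restrict_space)
  with part[OF N] show ?thesis by simp
qed

text \<open>Split the representative chosen by \<open>inv_into\<close> into its cut-offs: those on
  the other elements are orthogonal to \<open>w\<close>. The right-hand side does not depend on that
  choice.\<close>

lemma cinner_restriction:
  fixes clsY :: "(real \<Rightarrow> complex) \<Rightarrow> 'y::complex_hilbert"
  assumes mesh: "mesh x N"
    and fs: "function_space (omega_measure x N) XY clsY"
    and cut: "\<And>k h. k \<in> {1..N} \<Longrightarrow> h \<in> XY \<Longrightarrow> cut_off (element x k) h \<in> XY"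
    and orth: "orthogonal_direct_sum N (\<lambda>k. restricted_space XY clsY (element x k))"
    and k: "k \<in> {1..N}" and w: "w \<in> restricted_space XY clsY (element x k)"
  shows "cinner (restriction XY clsY (element x k) y) w = cinner y w"
proof -
  interpret function_space "omega_measure x N" XY clsY by (rule fs)
  define h where "h = inv_into XY clsY y"
  have h: "h \<in> XY" "clsY h = y"
    using cls_onto by (auto simp: h_def inv_into_into f_inv_into_f)
  have "cinner y w = (\<Sum>j=1..N. cinner (clsY (cut_off (element x j) h)) w)"
    using cls_eq_sum_cut_off[OF mesh fs cut orth h(1)] h(2) by (simp add: cinner_sum_left)
  also have "\<dots> = (\<Sum>j=1..N. if j = k then cinner (clsY (cut_off (element x k) h)) w else 0)"
  proof (rule sum.cong[OF refl])
    fix j assume j: "j \<in> {1..N}"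
    have "clsY (cut_off (element x j) h) \<in> restricted_space XY clsY (element x j)"
      using h unfolding restricted_space_def by blast
    then show "cinner (clsY (cut_off (element x j) h)) w =
        (if j = k then cinner (clsY (cut_off (element x k) h)) w else 0)"
      using orth j k w unfolding orthogonal_direct_sum_def by auto
  qed
  also have "\<dots> = cinner (clsY (cut_off (element x k) h)) w"
    using k by simp
  finally show ?thesis by (simp add: restriction_def h_def)
qed

section \<open>Padding networks and bounding their parameters\<close>

lemma network_class_eventually_bounded:
  assumes N: "1 \<le> N" and C: "filterlim C at_top sequentially"
    and v: "v \<in> network_class \<sigma> x N m cls"
  shows "\<forall>\<^sub>F n in sequentially. v \<in> bounded_network_class \<sigma> x N n (C n) cls"
proof -
  obtain W b c where v_eq: "v = cls (network \<sigma> x N m W b c)"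
    using v unfolding network_class_def by blast
  define W' where "W' = (\<lambda>k j. if j \<le> m then W k j else 0)"
  define b' where "b' = (\<lambda>k j. if j \<le> m then b k j else 0)"
  \<comment> \<open>The vanishing outer coefficients silence the added neurons, whatever the value
    of \<open>\<sigma>\<close> at 0.\<close>
  define c' where "c' = (\<lambda>k j. if j \<le> m then c k j else 0)"
  \<comment> \<open>A crude common bound for every single parameter. Since \<open>param_norm\<close>
    adds three maxima, it is at most three times \<open>K\<close>.\<close>
  define K where "K = (\<Sum>k=1..N. \<Sum>j=1..m. \<bar>W k j\<bar> + \<bar>b k j\<bar> + cmod (c k j))"
  have le: "\<bar>W k j\<bar> + \<bar>b k j\<bar> + cmod (c k j) \<le> K" if "k \<in> {1..N}" "j \<in> {1..m}" for k j
  proof -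
    have "\<bar>W k j\<bar> + \<bar>b k j\<bar> + cmod (c k j) \<le> (\<Sum>j=1..m. \<bar>W k j\<bar> + \<bar>b k j\<bar> + cmod (c k j))"
      using that by (intro member_le_sum) auto
    also have "\<dots> \<le> K"
      unfolding K_def using that
      by (intro member_le_sum[where f = "\<lambda>k. \<Sum>j=1..m. \<bar>W k j\<bar> + \<bar>b k j\<bar> + cmod (c k j)"])
         (auto intro!: sum_nonneg)
    finally show ?thesis .
  qed
  have K0: "0 \<le> K" unfolding K_def by (auto intro!: sum_nonneg)
  have "\<forall>\<^sub>F n in sequentially. K + K + K \<le> C n"
    using C by (simp add: filterlim_at_top)
  then show ?thesis
    \<comment> \<open>The bound \<open>m\<close> leaves room for all the original neurons; the bound
      1 keeps the index set of the inner maxima nonempty, also when \<open>m\<close> is 0.\<close>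
    using eventually_ge_at_top[of "max 1 m"]
  proof eventually_elim
    case (elim n)
    have "(\<Sum>j=1..n. c' k j * \<sigma> (W' k j * t + b' k j)) =
        (\<Sum>j=1..m. c k j * \<sigma> (W k j * t + b k j))" for k t
      using elim by (intro sum.mono_neutral_cong_right) (auto simp: W'_def b'_def c'_def)
    then have net: "network \<sigma> x N n W' b' c' = network \<sigma> x N m W b c"
      by (simp only: network_def)
    have p: "\<bar>W' k j\<bar> \<le> K \<and> \<bar>b' k j\<bar> \<le> K \<and> cmod (c' k j) \<le> K"
      if "k \<in> {1..N}" "j \<in> {1..n}" for k j
    proof (cases "j \<le> m")
      case True
      then have "\<bar>W k j\<bar> + \<bar>b k j\<bar> + cmod (c k j) \<le> K" using le that by simp
      moreover have "0 \<le> \<bar>W k j\<bar>" "0 \<le> \<bar>b k j\<bar>" "0 \<le> cmod (c k j)" by simp_all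
      ultimately have "\<bar>W k j\<bar> \<le> K \<and> \<bar>b k j\<bar> \<le> K \<and> cmod (c k j) \<le> K" by linarith
      with True show ?thesis by (simp add: W'_def b'_def c'_def)
    next
      case False
      then show ?thesis using K0 by (simp add: W'_def b'_def c'_def)
    qed
    have ne: "{1..n} \<noteq> {}" "{1..N} \<noteq> {}" using elim N by auto
    have "(MAX j\<in>{1..n}. \<bar>W' k j\<bar>) + (MAX j\<in>{1..n}. \<bar>b' k j\<bar>) + (MAX j\<in>{1..n}. cmod (c' k j))
        \<le> K + K + K" if "k \<in> {1..N}" for k
      using ne(1) p[OF that] by (intro add_mono Max.boundedI) auto
    then have "param_norm N n W' b' c' \<le> K + K + K"
      unfolding param_norm_def using ne(2) by (intro Max.boundedI) auto
    with elim have "param_norm N n W' b' c' \<le> C n" by simp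
    then show ?case
      unfolding bounded_network_class_def v_eq net[symmetric] by blast
  qed
qed

section \<open>Convergence of the minimal losses\<close>

theorem theorem4p1:
  fixes x :: "nat \<Rightarrow> real" and N :: nat
    and XV :: "(nat \<times> real \<Rightarrow> complex) set"
    and clsV :: "(nat \<times> real \<Rightarrow> complex) \<Rightarrow> 'v::complex_banach"
    and XY :: "(real \<Rightarrow> complex) set"
    and clsY :: "(real \<Rightarrow> complex) \<Rightarrow> 'y::complex_hilbert"
    and A :: "'v \<Rightarrow> 'y" and B :: "'v \<Rightarrow> 'z::complex_banach"
    and jump1 jump2 :: "'v \<Rightarrow> 'w::complex_banach"
    and f :: 'y and g :: 'z and u :: 'v
    and \<phi> :: "nat \<Rightarrow> nat \<Rightarrow> 'y"
    and \<sigma> :: "real \<Rightarrow> complex" and C :: "nat \<Rightarrow> real"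
    and \<tau> :: real and M :: "nat \<Rightarrow> nat" and u_min :: "nat \<Rightarrow> 'v"
  assumes "mesh x N"
    and "function_space (broken_measure x N) XV clsV"
    and "function_space (omega_measure x N) XY clsY"
    and "bounded_clinear A" and "bounded_clinear B"
    and "bounded_clinear jump1" and "bounded_clinear jump2"
    and "A u = f" and "B u = g" and "jump1 u = 0" and "jump2 u = 0"
    and "\<And>k h. k \<in> {1..N} \<Longrightarrow> h \<in> XY \<Longrightarrow> cut_off (element x k) h \<in> XY"
    and "orthogonal_direct_sum N (\<lambda>k. restricted_space XY clsY (element x k))"
    and "\<And>k. k \<in> {1..N} \<Longrightarrow>
           complete_orthonormal_basis (\<phi> k) (restricted_space XY clsY (element x k))"
    and "bounded (range \<sigma>)" and "smooth \<sigma>"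
    and "\<And>n. n \<ge> 1 \<Longrightarrow> C n > 0" and "mono_on {1..} C" and "filterlim C at_top sequentially"
    and "\<And>n W b c. n \<ge> 1 \<Longrightarrow> network \<sigma> x N n W b c \<in> XV"
    and "\<And>n. n \<ge> 1 \<Longrightarrow> compact (bounded_network_class \<sigma> x N n (C n) clsV)"
    and "closure (\<Union>n\<in>{1..}. network_class \<sigma> x N n clsV) = UNIV"
    and "\<tau> > 0"
    and "\<And>n. n \<ge> 1 \<Longrightarrow>
           is_arg_min (truncated_loss x N XY clsY \<phi> A B jump1 jump2 f g \<tau> M)
             (\<lambda>v. v \<in> bounded_network_class \<sigma> x N n (C n) clsV) (u_min n)"
  shows "(\<lambda>n. truncated_loss x N XY clsY \<phi> A B jump1 jump2 f g \<tau> M (u_min n)) \<longlonglongrightarrow> 0"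
proof -
  let ?J = "truncated_loss x N XY clsY \<phi> A B jump1 jump2 f g \<tau> M"
  have N: "1 \<le> N" using assms(1) by (simp add: mesh_def)
  \<comment> \<open>Eliminates \<open>restriction\<close>, whose definition through a chosen
    representative shows neither linearity nor continuity.\<close>
  have inner: "cinner (restriction XY clsY (element x k) y) (\<phi> k i) = cinner y (\<phi> k i)"
    if "k \<in> {1..N}" "i \<ge> 1" for k i y
    using cinner_restriction[OF assms(1,3,12,13) that(1)]
      complete_orthonormal_basis_in_space[OF assms(14)[OF that(1)] that(2)] by blast
  have J_eq: "?J = (\<lambda>v. (\<Sum>k=1..N. \<Sum>i=1..M k. (cmod (cinner (A v - f) (\<phi> k i)))\<^sup>2)
      + \<tau> * ((norm (B v - g))\<^sup>2 + (norm (jump1 v))\<^sup>2 + (norm (jump2 v))\<^sup>2))"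
    by (rule ext) (simp add: truncated_loss_def inner)
  have lin: "bounded_linear A" "bounded_linear B" "bounded_linear jump1" "bounded_linear jump2"
    using assms(4-7) by (simp_all add: bounded_clinear_def)
  have cont: "continuous_on UNIV ?J"
    unfolding J_eq
    by (intro continuous_intros bounded_linear.continuous_on[OF bounded_linear_cinner_left]
        bounded_linear.continuous_on[OF lin(1)] bounded_linear.continuous_on[OF lin(2)]
        bounded_linear.continuous_on[OF lin(3)] bounded_linear.continuous_on[OF lin(4)])
  have J_u: "?J u = 0"
    unfolding J_eq using assms(8-11) by (simp add: cinner_zero_left)
  have J_nonneg: "0 \<le> ?J v" for v
    unfolding J_eq using assms(23) by (auto intro!: add_nonneg_nonneg sum_nonneg mult_nonneg_nonneg)
  show ?thesis
  proof (rule order_tendstoI)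
    fix \<epsilon> :: real assume "\<epsilon> < 0"
    then show "\<forall>\<^sub>F n in sequentially. \<epsilon> < ?J (u_min n)"
      by (intro always_eventually allI less_le_trans[OF _ J_nonneg])
  next
    fix \<epsilon> :: real assume \<epsilon>: "0 < \<epsilon>"
    \<comment> \<open>This sublevel set is a neighbourhood of the exact solution, so it meets the
      dense union of network classes.\<close>
    have "open {v. ?J v < \<epsilon>}"
      by (rule open_Collect_less[OF cont]) (rule continuous_on_const)
    moreover have "u \<in> {v. ?J v < \<epsilon>}" using \<epsilon> J_u by simp
    moreover have "u \<in> closure (\<Union>n\<in>{1..}. network_class \<sigma> x N n clsV)"
      unfolding assms(22) by (rule UNIV_I)
    ultimately have "{v. ?J v < \<epsilon>} \<inter> (\<Union>n\<in>{1..}. network_class \<sigma> x N n clsV) \<noteq> {}"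
      using open_Int_closure_eq_empty by blast
    then obtain v m where v: "?J v < \<epsilon>" "v \<in> network_class \<sigma> x N m clsV"
      by blast
    from network_class_eventually_bounded[OF N assms(19) v(2)] eventually_ge_at_top[of 1]
    show "\<forall>\<^sub>F n in sequentially. ?J (u_min n) < \<epsilon>"
    proof eventually_elim
      case (elim n)
      \<comment> \<open>The fixed network \<open>v\<close> is now an admissible competitor in the
        \<open>n\<close>-th minimization.\<close>
      then have "?J (u_min n) \<le> ?J v"
        using assms(24)[OF elim(2)] unfolding is_arg_min_def not_less[symmetric] by blast
      with v(1) show ?case by simp
    qed
  qed
qed

end
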